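(* Let $d\ge 2$ be an integer and let $G$ be a finite simple $2d$-regular graph with connected components $G_1,G_2,\ldots,G_q$, where $G_1,\ldots,G_k$ ($0\le k\le q$) are exactly the components with an odd number of vertices, indexed so that $|G_1|\le |G_2|\le\cdots\le |G_k|$. Then: (1) If $0\le k\le 5d+4$, then $G$ admits an antimagic orientation. (2) If $k\ge 5d+5$, let $x_0$ be a positive integer satisfying one of the equations $k=(2d-2)(x+2)+r$ for some $r\in\{0,1,\ldots,d+8\}$, or $k=(2d-2)(x+1)+r$ for some $r\in\{d+9,d+10,\ldots,2d-3\}$ (the paper refers to $x_0$ as the unique positive integer solution of one of these equations). If $|G_1|\ge 2x_0+5$, then $G$ admits an antimagic orientation. *)

theory Defs
  imports Main
begin

definition simple_graph :: "'a set \<Rightarrow> 'a set set \<Rightarrow> bool" where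
  "simple_graph V E \<longleftrightarrow> finite V \<and> (\<forall>e\<in>E. e \<subseteq> V \<and> card e = 2)"

definition degree :: "'a set set \<Rightarrow> 'a \<Rightarrow> nat" where
  "degree E v = card {e\<in>E. v \<in> e}"

definition regular :: "'a set \<Rightarrow> 'a set set \<Rightarrow> nat \<Rightarrow> bool" where
  "regular V E r \<longleftrightarrow> (\<forall>v\<in>V. degree E v = r)"

definition adj :: "'a set set \<Rightarrow> 'a \<Rightarrow> 'a \<Rightarrow> bool" where
  "adj E u v \<longleftrightarrow> {u, v} \<in> E"

definition components :: "'a set \<Rightarrow> 'a set set \<Rightarrow> 'a set set" where
  "components V E = {{w\<in>V. (adj E)\<^sup>*\<^sup>* v w} | v. v \<in> V}"

definition odd_components :: "'a set \<Rightarrow> 'a set set \<Rightarrow> 'a set set" where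
  "odd_components V E = {C\<in>components V E. odd (card C)}"

definition odd_comp_count :: "'a set \<Rightarrow> 'a set set \<Rightarrow> nat" where
  "odd_comp_count V E = card (odd_components V E)"

definition min_odd_comp_size :: "'a set \<Rightarrow> 'a set set \<Rightarrow> nat" where
  "min_odd_comp_size V E = Min (card ` odd_components V E)"

text \<open>Orientation: head h e \<in> e for each edge e; tail is the other endpoint.
  Oriented vertex sum: sum of labels of arcs entering v minus sum of labels of arcs leaving v.\<close>
definition vertex_sum :: "'a set set \<Rightarrow> ('a set \<Rightarrow> 'a) \<Rightarrow> ('a set \<Rightarrow> nat) \<Rightarrow> 'a \<Rightarrow> int" where
  "vertex_sum E h f v =
     (\<Sum>e\<in>{e\<in>E. v \<in> e \<and> h e = v}. int (f e)) - (\<Sum>e\<in>{e\<in>E. v \<in> e \<and> h e \<noteq> v}. int (f e))"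

definition has_antimagic_orientation :: "'a set \<Rightarrow> 'a set set \<Rightarrow> bool" where
  "has_antimagic_orientation V E \<longleftrightarrow>
     (\<exists>h f. (\<forall>e\<in>E. h e \<in> e) \<and> bij_betw f E {1..card E} \<and> inj_on (vertex_sum E h f) V)"

end

theory Submission
  imports Defs "HOL-Library.Product_Lexorder"
begin

text \<open>
  Take an Euler tour of each component and cut it at the first visit of each
  vertex; a component with \<open>n\<close> vertices becomes a cyclic sequence of \<open>n\<close> trails. Orient each trail
  in either direction and give it consecutive labels, increasing along the orientation. Then each
  of the \<open>d - 1\<close> later visits of a vertex contributes \<open>- 1\<close> to its sum, so only the two trails
  meeting at its first visit matter.

  Let the orientations alternate around the sequence, so that these vertices are sinks and sources,
  except that an odd component has one vertex \<open>u\<close> through which trail 0, a single edge, continues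
  into trail 1. Order the trails of all components by their distance from trail 0. Then the sums at
  the sinks are positive and those at the sources are negative, and both are strictly monotone in
  the pair of trails involved, hence distinct. The sum at \<open>u\<close> is a negative label difference,
  smaller in absolute value than a label of each source; ordering the labels of the edges around
  the vertices \<open>u\<close> suitably makes these differences distinct as well.
\<close>

section \<open>Euler tours\<close>

definition step_edge :: "(nat \<Rightarrow> 'a) \<Rightarrow> nat \<Rightarrow> 'a set" where
  "step_edge w i = {w i, w (Suc i)}"

definition trail :: "'a set set \<Rightarrow> nat \<Rightarrow> (nat \<Rightarrow> 'a) \<Rightarrow> bool" where
  "trail F m w \<longleftrightarrow> step_edge w ` {..<m} \<subseteq> F \<and> inj_on (step_edge w) {..<m}"

definition euler_tour :: "'a set set \<Rightarrow> 'a set \<Rightarrow> nat \<Rightarrow> (nat \<Rightarrow> 'a) \<Rightarrow> bool" where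
  "euler_tour F C m w \<longleftrightarrow> m > 0 \<and> w m = w 0 \<and> inj_on (step_edge w) {..<m}
    \<and> step_edge w ` {..<m} = F \<and> w ` {..<m} = C"

lemma trail_length_le:
  assumes "finite F" "trail F m w"
  shows "m \<le> card F"
  using assms card_mono[of F "step_edge w ` {..<m}"] card_image[of "step_edge w" "{..<m}"]
  by (auto simp: trail_def)

text \<open>No step is a loop, so no single step both leaves and enters \<open>v\<close>, and
  departures and arrivals can be counted separately.\<close>

lemma card_incident_steps:
  assumes inj: "inj_on (step_edge w) {..<m}" and proper: "\<And>i. i < m \<Longrightarrow> w i \<noteq> w (Suc i)"
  shows "card {e \<in> step_edge w ` {..<m}. v \<in> e}
    = card {i. i < m \<and> w i = v} + card {i. i < m \<and> w (Suc i) = v}"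
proof -
  have "{e \<in> step_edge w ` {..<m}. v \<in> e}
    = step_edge w ` ({i. i < m \<and> w i = v} \<union> {i. i < m \<and> w (Suc i) = v})"
    by (auto simp: step_edge_def)
  moreover have "card (step_edge w ` ({i. i < m \<and> w i = v} \<union> {i. i < m \<and> w (Suc i) = v}))
    = card ({i. i < m \<and> w i = v} \<union> {i. i < m \<and> w (Suc i) = v})"
    by (rule card_image, rule inj_on_subset[OF inj]) auto
  moreover have "\<dots> = card {i. i < m \<and> w i = v} + card {i. i < m \<and> w (Suc i) = v}"
    by (rule card_Un_disjoint) (use proper in force)+
  ultimately show ?thesis by simp
qed

lemma sum_shift_one:
  fixes g :: "nat \<Rightarrow> 'b::comm_monoid_add"
  shows "(\<Sum>i<m. g (Suc i)) + g 0 = (\<Sum>i<m. g i) + g m"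
  by (metis add.commute sum.lessThan_Suc sum.lessThan_Suc_shift)

lemma card_shifted_visits:
  "card {i. i < m \<and> w (Suc i) = v} + (if w 0 = v then 1 else 0)
    = card {i. i < m \<and> w i = v} + (if w m = v then 1 else 0)"
proof -
  have "card {i. i < m \<and> P i} = (\<Sum>i<m. if P i then 1 else 0)" for P :: "nat \<Rightarrow> bool"
    by (simp add: sum.If_cases Int_def lessThan_def)
  then show ?thesis
    using sum_shift_one[of "\<lambda>i. if w i = v then 1 else (0::nat)" m] by simp
qed

lemma trail_extend:
  assumes tr: "trail F m w" and e: "{w m, x} \<in> F" "{w m, x} \<notin> step_edge w ` {..<m}"
  shows "trail F (Suc m) (w(Suc m := x))"
proof -
  have eq: "step_edge (w(Suc m := x)) i = step_edge w i" if "i < m" for i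
    using that by (auto simp: step_edge_def)
  have "step_edge (w(Suc m := x)) ` {..<m} = step_edge w ` {..<m}"
    using eq by (intro image_cong) auto
  moreover have "inj_on (step_edge (w(Suc m := x))) {..<m}"
    using tr eq by (auto simp: trail_def inj_on_def)
  moreover have "step_edge (w(Suc m := x)) m = {w m, x}"
    by (simp add: step_edge_def)
  ultimately show ?thesis
    using tr e by (auto simp: trail_def lessThan_Suc)
qed

text \<open>A closed trail can be restarted at any of its vertices, so that it ends there and can be
  extended from there.\<close>

lemma trail_rotate:
  assumes tr: "trail F m w" and closed: "w m = w 0" and "i < m"
  defines "w' \<equiv> \<lambda>j. w ((i + j) mod m)"
  shows "trail F m w'" "step_edge w' ` {..<m} = step_edge w ` {..<m}" "w' m = w i"
proof -
  let ?r = "\<lambda>j. (i + j) mod m"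
  have eq: "step_edge w' j = step_edge w (?r j)" for j
    using closed \<open>i < m\<close> by (simp add: step_edge_def w'_def mod_Suc)
  have inj: "inj_on ?r {..<m}"
  proof (rule inj_onI)
    fix a b assume "a \<in> {..<m}" "b \<in> {..<m}" "?r a = ?r b"
    moreover have "?r x = (if i + x < m then i + x else i + x - m)" if "x < m" for x
      using that \<open>i < m\<close> by (simp add: mod_if)
    ultimately show "a = b"
      using \<open>i < m\<close> by (auto split: if_splits)
  qed
  have r: "?r ` {..<m} = {..<m}"
    by (rule endo_inj_surj[OF _ _ inj]) (use \<open>i < m\<close> in auto)
  have comp: "step_edge w' = step_edge w \<circ> ?r"
    using eq by auto
  show img: "step_edge w' ` {..<m} = step_edge w ` {..<m}"
    unfolding comp image_comp[symmetric] r ..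
  have "inj_on (step_edge w') {..<m}"
    unfolding comp by (rule comp_inj_on[OF inj]) (use tr r in \<open>simp add: trail_def\<close>)
  then show "trail F m w'"
    using tr img by (simp add: trail_def)
  show "w' m = w i"
    using \<open>i < m\<close> by (simp add: w'_def)
qed

lemma doubleton_with_memberE:
  assumes "card e = 2" "v \<in> e"
  obtains x where "e = {v, x}"
  using assms by (auto simp: card_2_iff)

lemma longest_trail_closed:
  assumes card2: "\<And>e. e \<in> F \<Longrightarrow> card e = 2"
    and even_deg: "\<And>v. even (degree F v)"
    and tr: "trail F m w" and longest: "\<And>m' w'. trail F m' w' \<Longrightarrow> m' \<le> m"
  shows "w m = w 0"
proof (rule ccontr)
  assume ne: "w m \<noteq> w 0"
  let ?S = "{e \<in> step_edge w ` {..<m}. w m \<in> e}"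
  let ?N = "{e \<in> F. w m \<in> e}"
  have "w i \<noteq> w (Suc i)" if "i < m" for i
  proof -
    have "card (step_edge w i) = 2" using card2 tr that by (auto simp: trail_def)
    then show ?thesis by (auto simp: step_edge_def)
  qed
  then have "card ?S = card {i. i < m \<and> w i = w m} + card {i. i < m \<and> w (Suc i) = w m}"
    using tr card_incident_steps[of w m "w m"] by (simp add: trail_def)
  moreover have "card {i. i < m \<and> w (Suc i) = w m} = Suc (card {i. i < m \<and> w i = w m})"
    using card_shifted_visits[of m w "w m"] ne by simp
  ultimately have "odd (card ?S)" by simp
  then have "?S \<noteq> ?N" using even_deg[of "w m"] by (auto simp: degree_def)
  then obtain e where e: "e \<in> F" "w m \<in> e" "e \<notin> step_edge w ` {..<m}"
    using tr by (auto simp: trail_def)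
  then obtain x where "e = {w m, x}"
    using card2[of e] by (blast elim: doubleton_with_memberE)
  then show False
    using longest trail_extend[OF tr] e by (metis Suc_n_not_le_n)
qed

lemma longest_trail_exhausts:
  assumes tr: "trail F m w" and longest: "\<And>m' w'. trail F m' w' \<Longrightarrow> m' \<le> m"
    and closed: "w m = w 0" and "i < m" and e: "{w i, x} \<in> F"
  shows "{w i, x} \<in> step_edge w ` {..<m}"
proof (rule ccontr)
  assume "{w i, x} \<notin> step_edge w ` {..<m}"
  then show False
    using trail_extend[of F m "\<lambda>j. w ((i + j) mod m)" x] trail_rotate[OF tr closed \<open>i < m\<close>] e longest
    by (metis Suc_n_not_le_n)
qed

section \<open>Components and their Euler tours\<close>

lemma component_closed:
  assumes "simple_graph V E" "C \<in> components V E" "v \<in> C" "{v, x} \<in> E"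
  shows "x \<in> C"
proof -
  have "x \<in> V" using assms by (auto simp: simple_graph_def)
  then show ?thesis
    using assms by (auto simp: components_def adj_def intro: rtranclp.rtrancl_into_rtrancl)
qed

lemma component_connected:
  assumes "simple_graph V E" "C \<in> components V E" "v \<in> C" "x \<in> C"
  shows "(adj E)\<^sup>*\<^sup>* v x"
proof -
  have "symp (adj E)" by (auto simp: symp_def adj_def insert_commute)
  then have "symp (adj E)\<^sup>*\<^sup>*" by (simp add: symp_rtranclp)
  then show ?thesis
    using assms by (auto simp: components_def dest: sympD intro: rtranclp_trans)
qed

lemma finite_edges: "simple_graph V E \<Longrightarrow> finite E"
  by (rule finite_subset[of _ "Pow V"]) (auto simp: simple_graph_def)

lemma component_degree:
  assumes "simple_graph V E" "C \<in> components V E"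
  shows "degree {e \<in> E. e \<subseteq> C} v = (if v \<in> C then degree E v else 0)"
proof -
  have "e \<subseteq> C" if "e \<in> E" "v \<in> e" "v \<in> C" for e
  proof -
    have "card e = 2" using that assms(1) by (simp add: simple_graph_def)
    then obtain x where "e = {v, x}" using \<open>v \<in> e\<close> by (rule doubleton_with_memberE)
    then show ?thesis using component_closed[OF assms] that by auto
  qed
  then have "{e \<in> {e \<in> E. e \<subseteq> C}. v \<in> e} = (if v \<in> C then {e \<in> E. v \<in> e} else {})"
    by auto
  then show ?thesis by (simp add: degree_def)
qed

text \<open>A longest trail inside \<open>C\<close> is closed and uses every edge at each vertex it
  visits. By connectivity it then reaches all of \<open>C\<close>.\<close>

lemma component_euler_tour:
  assumes sg: "simple_graph V E" and C: "C \<in> components V E"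
    and deg: "\<And>v. v \<in> V \<Longrightarrow> even (degree E v) \<and> degree E v > 0"
  shows "\<exists>m w. euler_tour {e \<in> E. e \<subseteq> C} C m w"
proof -
  let ?F = "{e \<in> E. e \<subseteq> C}"
  have fin: "finite ?F" using finite_edges[OF sg] by simp
  have CV: "C \<subseteq> V" "C \<noteq> {}" using C by (auto simp: components_def)
  have card2: "card e = 2" if "e \<in> ?F" for e using that sg by (simp add: simple_graph_def)
  have "trail ?F 0 undefined" by (simp add: trail_def)
  then have "\<exists>w. trail ?F 0 w" by blast
  then have "\<exists>m. (\<exists>w. trail ?F m w) \<and> (\<forall>m'. (\<exists>w. trail ?F m' w) \<longrightarrow> m' \<le> m)"
    by (rule ex_has_greatest_nat[where f = "\<lambda>m. m" and b = "Suc (card ?F)"])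
      (use trail_length_le[OF fin] in \<open>auto simp: less_Suc_eq_le\<close>)
  then obtain m where "\<exists>w. trail ?F m w" and longest: "\<And>m' w'. trail ?F m' w' \<Longrightarrow> m' \<le> m"
    by blast
  then obtain w where tr: "trail ?F m w" by blast
  have even_deg: "even (degree ?F v)" for v
    using deg CV component_degree[OF sg C, of v] by auto
  have closed: "w m = w 0"
    by (rule longest_trail_closed[OF _ _ tr]) (fact card2 even_deg longest)+
  have "m > 0"
  proof -
    obtain v where "v \<in> C" using CV by blast
    then have "degree ?F v > 0" using component_degree[OF sg C, of v] deg[of v] CV by auto
    then obtain e where "e \<in> ?F" by (metis (mono_tags, lifting) card_gt_0_iff degree_def empty_Collect_eq)
    then obtain a b where "{a, b} \<in> ?F" using card2 by (metis card_2_iff)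
    then have "trail ?F 1 ((\<lambda>_. a)(1 := b))" by (auto simp: trail_def step_edge_def inj_on_def)
    then show ?thesis using longest by fastforce
  qed
  have WC: "w ` {..<m} \<subseteq> C" using tr by (auto simp: trail_def step_edge_def)
  have step: "y \<in> w ` {..<m} \<and> {x, y} \<in> step_edge w ` {..<m}" if xy: "x \<in> w ` {..<m}" "{x, y} \<in> E" for x y
  proof -
    have "x \<in> C" using xy WC by blast
    then have "{x, y} \<in> ?F" using component_closed[OF sg C _ xy(2)] xy by auto
    then have mem: "{x, y} \<in> step_edge w ` {..<m}"
      using longest_trail_exhausts[OF tr _ closed] longest xy(1) by blast
    then obtain i where "i < m" "{x, y} = {w i, w (Suc i)}" by (auto simp: step_edge_def)
    \<comment> \<open>The last step ends at \<open>w m\<close>, which is \<open>w 0\<close> and thus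
      already among the visited positions.\<close>
    moreover have "w (Suc i) \<in> w ` {..<m}" if "i < m" for i
      using that closed \<open>m > 0\<close> by (cases "Suc i = m") auto
    ultimately have "y \<in> w ` {..<m}" by (metis image_eqI insertCI insertE lessThan_iff singletonD)
    then show ?thesis using mem by blast
  qed
  have CW: "C \<subseteq> w ` {..<m}"
  proof
    fix x assume "x \<in> C"
    then have "(adj E)\<^sup>*\<^sup>* (w 0) x"
      using component_connected[OF sg C] WC \<open>m > 0\<close> by blast
    then show "x \<in> w ` {..<m}"
      by (induction rule: rtranclp_induct) (use \<open>m > 0\<close> step in \<open>auto simp: adj_def\<close>)
  qed
  have "?F \<subseteq> step_edge w ` {..<m}"
  proof
    fix e assume e: "e \<in> ?F"
    then obtain a b where "e = {a, b}" using card2 by (metis card_2_iff)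
    then show "e \<in> step_edge w ` {..<m}" using e CW step[of a b] by auto
  qed
  then have "step_edge w ` {..<m} = ?F" using tr by (auto simp: trail_def)
  then show ?thesis using \<open>m > 0\<close> closed tr WC CW by (auto simp: trail_def euler_tour_def)
qed

section \<open>Labelling by rank\<close>

definition rank :: "'i set \<Rightarrow> ('i \<Rightarrow> 'k::linorder) \<Rightarrow> 'i \<Rightarrow> nat" where
  "rank I key x = card {y \<in> I. key y \<le> key x}"

lemma rank_less:
  assumes "finite I" "y \<in> I" "key x < key y"
  shows "rank I key x < rank I key y"
proof -
  have "{z \<in> I. key z \<le> key x} \<subseteq> {z \<in> I. key z \<le> key y}" using assms by auto
  moreover have "y \<in> {z \<in> I. key z \<le> key y} - {z \<in> I. key z \<le> key x}" using assms by auto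
  ultimately have "{z \<in> I. key z \<le> key x} \<subset> {z \<in> I. key z \<le> key y}" by blast
  then show ?thesis unfolding rank_def using assms by (intro psubset_card_mono) auto
qed

text \<open>Serves to show that neighbouring steps of one trail get consecutive labels.\<close>

lemma rank_Suc:
  assumes "finite I" "inj_on key I" "y \<in> I" "key x < key y"
    and between: "\<And>z. z \<in> I \<Longrightarrow> key x < key z \<Longrightarrow> key z < key y \<Longrightarrow> False"
  shows "rank I key y = Suc (rank I key x)"
proof -
  have "{z \<in> I. key z \<le> key y} = insert y {z \<in> I. key z \<le> key x}"
    using assms by (fastforce simp: inj_on_def not_less)
  then show ?thesis using assms by (simp add: rank_def)
qed

lemma bij_betw_rank:
  assumes "finite I" "inj_on key I"
  shows "bij_betw (rank I key) I {1..card I}"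
proof -
  have inj: "inj_on (rank I key) I"
  proof (rule inj_onI)
    fix x y assume xy: "x \<in> I" "y \<in> I" "rank I key x = rank I key y"
    then have "key x = key y"
      using rank_less[of I x key y] rank_less[of I y key x] assms(1) by (metis less_irrefl neqE)
    then show "x = y" using xy assms(2) by (auto dest: inj_onD)
  qed
  have "rank I key ` I \<subseteq> {1..card I}"
  proof
    fix r assume "r \<in> rank I key ` I"
    then obtain x where x: "x \<in> I" "r = rank I key x" by auto
    then have "x \<in> {y \<in> I. key y \<le> key x}" by simp
    then have "0 < r" unfolding x(2) rank_def using assms(1) card_gt_0_iff by fastforce
    moreover have "r \<le> card I" unfolding x(2) rank_def using assms(1) by (intro card_mono) auto
    ultimately show "r \<in> {1..card I}" by simp
  qed
  then show ?thesis
    using card_subset_eq[of "{1..card I}" "rank I key ` I"] card_image[OF inj] inj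
    by (simp add: bij_betw_def)
qed

section \<open>Orientation and labelling along tours\<close>

text \<open>What the construction uses of the graph: one Euler tour per component, odd components
  numbered first. In a \<open>2d\<close>-regular graph each visit uses two edges, whence
  \<open>d\<close> visits per vertex; \<open>large\<close> comes from
  \<open>2d + 1 \<ge> 5\<close>.\<close>

locale tours =
  fixes q k d :: nat and m :: "nat \<Rightarrow> nat" and w :: "nat \<Rightarrow> nat \<Rightarrow> 'a"
  assumes m_pos: "c < q \<Longrightarrow> 0 < m c"
    and closed: "c < q \<Longrightarrow> w c (m c) = w c 0"
    and proper: "c < q \<Longrightarrow> i < m c \<Longrightarrow> w c i \<noteq> w c (Suc i)"
    and disjoint: "c < q \<Longrightarrow> c' < q \<Longrightarrow> i < m c \<Longrightarrow> i' < m c' \<Longrightarrow> w c i = w c' i' \<Longrightarrow> c = c'"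
    and visits: "c < q \<Longrightarrow> i < m c \<Longrightarrow> card {j. j < m c \<and> w c j = w c i} = d"
    and odd_first: "c < q \<Longrightarrow> odd (card (w c ` {..<m c})) \<longleftrightarrow> c < k"
    and k_le: "k \<le> q"
    and large: "c < k \<Longrightarrow> 5 \<le> card (w c ` {..<m c})"
begin

abbreviation n :: "nat \<Rightarrow> nat" where
  "n c \<equiv> card (w c ` {..<m c})"

text \<open>A new trail begins at each first visit, so counting the distinct vertices met so far
  numbers the trail that contains step \<open>i\<close>, starting from 0.\<close>

definition trail_no :: "nat \<Rightarrow> nat \<Rightarrow> nat" where
  "trail_no c i = card (w c ` {..i}) - 1"

definition fresh :: "nat \<Rightarrow> nat \<Rightarrow> bool" where
  "fresh c i \<longleftrightarrow> w c i \<notin> w c ` {..<i}"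

definition fwd :: "nat \<Rightarrow> nat \<Rightarrow> bool" where
  "fwd c j \<longleftrightarrow> odd j \<or> c < k \<and> j = 0"

text \<open>The labels of a tour grow from its trail 0 towards the middle of the cyclic sequence of trails,
  on both sides at once. The exceptions for odd tours put the single edge of trail 0 before
  everything else and trail 2 next to trail 1; the latter makes the label gap at the vertex between
  trails 0 and 1 strictly increasing in \<open>c\<close>.\<close>

definition lev :: "nat \<Rightarrow> nat \<Rightarrow> nat" where
  "lev c j = (if c < k then if j = 0 then 0 else if j = 2 then 1 else min j (n c + 1 - j)
    else min j (n c - j))"

definition steps :: "(nat \<times> nat) set" where
  "steps = (SIGMA c:{..<q}. {..<m c})"

text \<open>Compared lexicographically: odd tours come first, then lower levels. The tour and the
  trail number keep each trail contiguous, and the last entry makes labels grow along the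
  orientation, against the tour on backward trails.\<close>

definition key :: "nat \<times> nat \<Rightarrow> nat \<times> nat \<times> nat \<times> nat \<times> nat" where
  "key = (\<lambda>(c, i). (of_bool (\<not> c < k), lev c (trail_no c i), c, trail_no c i,
     if fwd c (trail_no c i) then i else m c - i))"

definition lab :: "nat \<Rightarrow> nat \<Rightarrow> int" where
  "lab c i = int (rank steps key (c, i))"

text \<open>The label read as a flow in the direction of the tour; an arc against the tour carries
  negative flow.\<close>

definition sgn_lab :: "nat \<Rightarrow> nat \<Rightarrow> int" where
  "sgn_lab c i = (if fwd c (trail_no c i) then lab c i else - lab c i)"

text \<open>Equals the vertex sum for the orientation and labelling above.\<close>

definition net :: "'a \<Rightarrow> int" where
  "net v = (\<Sum>(c, i)\<in>steps. sgn_lab c i * (of_bool (w c (Suc i) = v) - of_bool (w c i = v)))"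

definition pre :: "nat \<Rightarrow> nat \<Rightarrow> nat" where
  "pre c i = (if i = 0 then m c - 1 else i - 1)"

definition pre_trail :: "nat \<Rightarrow> nat \<Rightarrow> nat" where
  "pre_trail c j = (if j = 0 then n c - 1 else j - 1)"

section \<open>Numbering of the trails along a tour\<close>

lemma two_steps: "c < q \<Longrightarrow> 2 \<le> m c"
  using proper[of c 0] closed[of c] m_pos[of c] by (cases "m c = 1") auto

lemma trail_no_0 [simp]: "trail_no c 0 = 0"
  by (simp add: trail_no_def)

lemma trail_no_Suc: "trail_no c (Suc i) = trail_no c i + of_bool (fresh c (Suc i))"
proof -
  have "card (w c ` {..i}) > 0" by (simp add: card_gt_0_iff)
  then show ?thesis
    by (auto simp: trail_no_def fresh_def atMost_Suc lessThan_Suc_atMost insert_absorb)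
qed

lemma trail_no_mono: "i \<le> i' \<Longrightarrow> trail_no c i \<le> trail_no c i'"
  by (rule lift_Suc_mono_le[of "trail_no c"]) (simp_all add: trail_no_Suc)

lemma trail_no_less: 
  assumes "c < q" "i < m c" 
  shows "trail_no c i < n c"
proof -
  have "card (w c ` {..i}) \<le> n c" using assms by (intro card_mono) auto
  moreover have "card (w c ` {..i}) > 0" by (simp add: card_gt_0_iff)
  ultimately show ?thesis by (simp add: trail_no_def)
qed

lemma trail_no_last: "c < q \<Longrightarrow> trail_no c (m c - 1) = n c - 1"
  using m_pos[of c] by (simp add: trail_no_def flip: lessThan_Suc_atMost)

text \<open>The vertex \<open>w c 1\<close> differs from \<open>w c 0\<close> and is therefore new,
  so trail 0 is a single edge.\<close>

lemma trail_no_1: "c < q \<Longrightarrow> trail_no c 1 = 1"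
  using proper[of c 0] m_pos[of c] trail_no_Suc[of c 0] by (auto simp: fresh_def)

lemma trail_no_eq_0: "c < q \<Longrightarrow> trail_no c i = 0 \<longleftrightarrow> i = 0"
  using trail_no_mono[of 1 i c] trail_no_1[of c] by (cases i) auto

lemma trail_no_fresh:
  assumes "fresh c i" "i' < i"
  shows "trail_no c i' < trail_no c i"
proof -
  obtain l where "i = Suc l" "i' \<le> l" using assms(2) by (cases i) auto
  then show ?thesis using assms(1) trail_no_Suc[of c l] trail_no_mono[of i' l c] by simp
qed

lemma fresh_inj: "fresh c i \<Longrightarrow> fresh c i' \<Longrightarrow> trail_no c i = trail_no c i' \<Longrightarrow> i = i'"
  using trail_no_fresh[of c i i'] trail_no_fresh[of c i' i] by (cases i i' rule: linorder_cases) auto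

lemma trail_no_pre:
  assumes "c < q" "i < m c"
  shows "trail_no c (pre c i) = (if fresh c i then pre_trail c (trail_no c i) else trail_no c i)"
proof (cases i)
  \<comment> \<open>Position 0 is a first visit; the step cyclically before it is the last one of
    the tour, which lies in trail \<open>n c - 1\<close>.\<close>
  case 0
  then show ?thesis using assms trail_no_last by (simp add: pre_def pre_trail_def fresh_def)
next
  case (Suc i')
  then show ?thesis using trail_no_Suc[of c i'] by (simp add: pre_def pre_trail_def)
qed

lemma pre_less: "c < q \<Longrightarrow> i < m c \<Longrightarrow> pre c i < m c"
  by (auto simp: pre_def)

section \<open>Labels along the trails and the sum at a vertex\<close>

lemma finite_steps: "finite steps"
  by (simp add: steps_def)

lemma inj_key: "inj_on key steps"
  by (auto simp: inj_on_def key_def steps_def split: if_splits)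

lemma lab_less:
  assumes "c' < q" "i' < m c'" "key (c, i) < key (c', i')"
  shows "lab c i < lab c' i'"
  using rank_less[OF finite_steps, of "(c', i')" key "(c, i)"] assms by (simp add: lab_def steps_def)

lemma lab_Suc:
  assumes "c' < q" "i' < m c'" "key (c, i) < key (c', i')"
    and "\<And>c'' i''. c'' < q \<Longrightarrow> i'' < m c'' \<Longrightarrow> key (c, i) < key (c'', i'') \<Longrightarrow> key (c'', i'') < key (c', i') \<Longrightarrow> False"
  shows "lab c' i' = lab c i + 1"
proof -
  have "rank steps key (c', i') = Suc (rank steps key (c, i))"
    by (rule rank_Suc[OF finite_steps inj_key]) (use assms in \<open>auto simp: steps_def\<close>)
  then show ?thesis by (simp add: lab_def)
qed

lemma lab_pos: "c < q \<Longrightarrow> i < m c \<Longrightarrow> 0 < lab c i"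
  using bij_betwE[OF bij_betw_rank[OF finite_steps inj_key]] by (force simp: lab_def steps_def)

text \<open>Both steps lie in one trail and their keys differ by one in the last entry only, so
  their labels are consecutive. Reversing the trail flips both the signs and the order, which leaves
  the difference unchanged.\<close>

lemma sgn_lab_stale:
  assumes "c < q" "i < m c" "\<not> fresh c i"
  shows "sgn_lab c (pre c i) - sgn_lab c i = - 1"
proof -
  obtain i' where i: "i = Suc i'" using assms(3) by (cases i) (auto simp: fresh_def)
  have t: "trail_no c i' = trail_no c i" using trail_no_Suc[of c i'] assms i by simp
  show ?thesis
  proof (cases "fwd c (trail_no c i)")
    case True
    then have "lab c i = lab c i' + 1"
      using assms t i by (intro lab_Suc) (auto simp: key_def)
    then show ?thesis using True t i by (simp add: sgn_lab_def pre_def)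
  next
    case False
    then have "lab c i' = lab c i + 1"
      using assms t i by (intro lab_Suc) (auto simp: key_def)
    then show ?thesis using False t i by (simp add: sgn_lab_def pre_def)
  qed
qed

text \<open>Each of the \<open>d\<close> visits contributes its incoming minus its outgoing flow; by
  \<open>sgn_lab_stale\<close> this is \<open>- 1\<close> at all visits except the first.\<close>

lemma net_fresh:
  assumes c: "c < q" "i < m c" "fresh c i"
  shows "net (w c i) = sgn_lab c (pre c i) - sgn_lab c i - (int d - 1)"
proof -
  let ?v = "w c i" and ?A = "{j. j < m c \<and> w c j = w c i}"
  have other: "w c' j \<noteq> ?v" "w c' (Suc j) \<noteq> ?v" if "c' < q" "c' \<noteq> c" "j < m c'" for c' j
  proof -
    show "w c' j \<noteq> ?v" using disjoint[of c' c j i] that c by auto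
    show "w c' (Suc j) \<noteq> ?v"
    proof (cases "Suc j = m c'")
      case True
      then show ?thesis using disjoint[of c' c 0 i] that c closed[of c'] m_pos by auto
    next
      case False
      then show ?thesis using disjoint[of c' c "Suc j" i] that c by auto
    qed
  qed
  let ?f = "\<lambda>c j. sgn_lab c j * (of_bool (w c (Suc j) = ?v) - of_bool (w c j = ?v))"
  let ?g = "\<lambda>j. sgn_lab c (pre c j) * of_bool (w c j = ?v)"
  have "net ?v = (\<Sum>c'<q. \<Sum>j<m c'. ?f c' j)"
    by (simp add: net_def steps_def sum.Sigma)
  also have "\<dots> = (\<Sum>c'<q. if c' = c then \<Sum>j<m c. ?f c j else 0)"
    using other by (intro sum.cong) (auto intro!: sum.neutral)
  also have "\<dots> = (\<Sum>j<m c. ?f c j)"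
    using c by simp
  \<comment> \<open>Since \<open>pre c (Suc j) = j\<close>, the arrivals form a shifted sum of
    \<open>?g\<close>. As the tour is closed, the shift does not change the sum, and arrivals get
    paired with departures at the same visit.\<close>
  also have "\<dots> = (\<Sum>j<m c. ?g (Suc j)) - (\<Sum>j<m c. sgn_lab c j * of_bool (w c j = ?v))"
    by (simp add: right_diff_distrib sum_subtractf pre_def)
  also have "(\<Sum>j<m c. ?g (Suc j)) = (\<Sum>j<m c. ?g j)"
    using sum_shift_one[of ?g "m c"] closed[of c] m_pos[of c] c by (simp add: pre_def)
  also have "(\<Sum>j<m c. ?g j) - (\<Sum>j<m c. sgn_lab c j * of_bool (w c j = ?v))
    = (\<Sum>j<m c. if w c j = ?v then sgn_lab c (pre c j) - sgn_lab c j else 0)"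
    by (subst sum_subtractf[symmetric], rule sum.cong) auto
  also have "\<dots> = (\<Sum>j\<in>?A. sgn_lab c (pre c j) - sgn_lab c j)"
    by (rule sum.mono_neutral_cong_right) auto
  also have "\<dots> = sgn_lab c (pre c i) - sgn_lab c i + (\<Sum>j\<in>?A - {i}. sgn_lab c (pre c j) - sgn_lab c j)"
    using c by (subst sum.remove[of _ i]) auto
  also have "(\<Sum>j\<in>?A - {i}. sgn_lab c (pre c j) - sgn_lab c j) = (\<Sum>j\<in>?A - {i}. - 1)"
  proof (intro sum.cong refl sgn_lab_stale c(1))
    fix j assume j: "j \<in> ?A - {i}"
    then show "j < m c" by simp
    have "\<not> j < i" using j c(3) by (metis (mono_tags) DiffD1 fresh_def image_eqI lessThan_iff mem_Collect_eq)
    then have "w c j = w c i" "i < j" using j by auto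
    then show "\<not> fresh c j" unfolding fresh_def by (metis image_eqI lessThan_iff)
  qed
  also have "\<dots> = - (int d - 1)"
  proof -
    have "card (?A - {i}) = d - 1" using c visits[of c i] by (simp add: card_Diff_singleton)
    moreover have "card ?A > 0" using c by (auto simp: card_gt_0_iff)
    then have "d > 0" using c visits[of c i] by simp
    ultimately show ?thesis by simp
  qed
  finally show ?thesis by simp
qed

text \<open>The vertex at the start of trail \<open>j\<close> receives (\<open>sink\<close>) or emits (\<open>source\<close>) both trails
  meeting there. The only other case is \<open>j = 1\<close> in an odd tour.\<close>

definition sink :: "nat \<Rightarrow> nat \<Rightarrow> bool" where
  "sink c j \<longleftrightarrow> even j \<and> \<not> (c < k \<and> j = 0)"

definition source :: "nat \<Rightarrow> nat \<Rightarrow> bool" where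
  "source c j \<longleftrightarrow> odd j \<and> \<not> (c < k \<and> j = 1) \<or> c < k \<and> j = 0"

text \<open>Closed forms for the lower level (\<open>lo\<close>) and the higher level
  (\<open>hi\<close>) of the two trails meeting at the start of trail \<open>j\<close>, except at
  \<open>j = 1\<close> in an odd tour. The special cases stem from those in
  \<open>lev\<close>.\<close>

definition lo :: "nat \<Rightarrow> nat \<Rightarrow> nat" where
  "lo c j = (if j = 0 then 0
    else if c < k then if j \<le> 3 then 1 else min (j - 1) (n c + 1 - j)
    else min (j - 1) (n c - j))"

definition hi :: "nat \<Rightarrow> nat \<Rightarrow> nat" where
  "hi c j = (if c < k then if j = 0 then 2 else if j = 2 then 1 else if j = 3 then 3 else Suc (lo c j)
    else Suc (lo c j))"

section \<open>Levels of the two trails meeting at a vertex\<close>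

lemma half_size:
  assumes "c < q"
  obtains h where "c < k" "n c = 2 * h + 1" "2 \<le> h" | h where "\<not> c < k" "n c = 2 * h"
proof (cases "c < k")
  case True
  then have "odd (n c)" "5 \<le> n c" using assms odd_first large by auto
  then show ?thesis using True that(1) by (auto elim!: oddE)
next
  case False
  then have "even (n c)" using assms odd_first by auto
  then show ?thesis using False that(2) by (auto elim!: evenE)
qed

text \<open>Apart from the exceptions near trail 0, levels rise up to the middle of the cyclic
  sequence and then fall; the case split separates the two flanks, on which the lower trail is the
  earlier or the later one.\<close>

lemma lev_ends:
  assumes "c < q" "j < n c" "\<not> (c < k \<and> j = 1)"
  shows "lev c (pre_trail c j) = lo c j \<and> lev c j = hi c j
    \<or> lev c (pre_trail c j) = hi c j \<and> lev c j = lo c j"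
  using \<open>c < q\<close>
proof (cases rule: half_size)
  case (1 h)
  consider "j = 0" | "j = 2" | "j = 3" | "4 \<le> j" "j \<le> h + 1" | "4 \<le> j" "h + 2 \<le> j"
    using assms 1 by linarith
  then show ?thesis
    using assms 1 by cases (simp_all add: lev_def lo_def hi_def pre_trail_def min_def, arith+)
next
  case (2 h)
  consider "j = 0" | "1 \<le> j" "j \<le> h" | "h + 1 \<le> j"
    using assms 2 by linarith
  then show ?thesis
    using assms 2 by cases (simp_all add: lev_def lo_def hi_def pre_trail_def min_def, arith+)
qed

text \<open>Makes \<open>hi\<close> a strictly increasing function of \<open>lo\<close> among the
  sinks of tours of one parity: the excluded value 0 in odd tours would give the same
  \<open>hi\<close> as 1.\<close>

lemma sink_hi:
  assumes "sink c j" "c < q" "j < n c"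
  shows "hi c j = (if c < k \<and> lo c j = 1 then 1 else Suc (lo c j)) \<and> (c < k \<longrightarrow> lo c j \<noteq> 0)"
  using \<open>c < q\<close>
proof (cases rule: half_size)
  case (1 h)
  then obtain a where "j = 2 * a" "1 \<le> a" using assms(1) by (auto simp: sink_def elim!: evenE)
  then show ?thesis
    using assms 1 by (cases "a = 1") (auto simp: hi_def lo_def min_def)
next
  case (2 h)
  then show ?thesis by (simp add: hi_def)
qed

text \<open>The analogue for sources: in odd tours the excluded value 2 would give the same
  \<open>hi\<close> as 1. It does not occur because trail \<open>n c - 1\<close> starts at a
  sink.\<close>

lemma source_hi:
  assumes "source c j" "c < q" "j < n c"
  shows "hi c j = (if c < k \<and> lo c j \<le> 1 then lo c j + 2 else Suc (lo c j)) \<and> (c < k \<longrightarrow> lo c j \<noteq> 2)"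
  using \<open>c < q\<close>
proof (cases rule: half_size)
  case (1 h)
  then consider "j = 0" | a where "j = 2 * a + 1" "1 \<le> a"
    using assms(1) by (auto simp: source_def elim!: oddE)
  then show ?thesis
  proof cases
    case (2 a)
    then show ?thesis using assms 1 by (cases "a = 1") (auto simp: hi_def lo_def min_def)
  qed (use 1 in \<open>auto simp: hi_def lo_def\<close>)
next
  case (2 h)
  then show ?thesis by (simp add: hi_def)
qed

text \<open>Two different \<open>j\<close>, \<open>j'\<close> with equal \<open>lo\<close> have an
  odd sum, while two sinks, or two sources, agree in parity. The exception is the source 0 of an odd
  tour, the only one there with \<open>lo\<close> equal to 0.\<close>

lemma lo_inj:
  assumes ty: "sink c j \<and> sink c j' \<or> source c j \<and> source c j'"
    and "c < q" "j < n c" "j' < n c" "lo c j = lo c j'"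
  shows "j = j'"
proof (cases "c < k \<and> (j = 0 \<or> j' = 0)")
  case True
  then show ?thesis
    using assms by (auto simp: lo_def sink_def source_def min_def split: if_splits)
next
  case False
  then have par: "even j \<longleftrightarrow> even j'" "c < k \<Longrightarrow> 2 \<le> j \<and> 2 \<le> j'"
    using ty by (auto simp: sink_def source_def le_eq_less_or_eq Suc_le_eq numeral_2_eq_2)
  show ?thesis using \<open>c < q\<close>
  proof (cases rule: half_size)
    case (1 h)
    have lo: "lo c l = (if l \<le> 3 then 1 else if l \<le> h + 1 then l - 1 else 2 * h + 2 - l)"
      if "2 \<le> l" for l
      using 1 that by (simp add: lo_def min_def)
    have "j \<le> 3 \<and> j' \<le> 3 \<or> j = j' \<or> j + j' = 2 * h + 3"
      using par(2)[OF 1(1)] assms 1 by (simp add: lo split: if_splits)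
    then show ?thesis using par 1(1) by presburger
  next
    case (2 h)
    have lo: "lo c l = (if l = 0 then 0 else if l \<le> h then l - 1 else 2 * h - l)" for l
      using 2 by (simp add: lo_def min_def)
    have "j \<le> 1 \<and> j' \<le> 1 \<or> j = j' \<or> j + j' = 2 * h + 1"
      using assms 2 by (simp add: lo split: if_splits) arith
    then show ?thesis using par(1) by presburger
  qed
qed

lemma fwd_sink:
  assumes "sink c j" "c < q" "j < n c"
  shows "fwd c (pre_trail c j)" "\<not> fwd c j"
  using assms odd_first[of c] by (auto simp: sink_def fwd_def pre_trail_def)

text \<open>If \<open>j = 0\<close>, the tour is odd, and the preceding trail \<open>n c - 1\<close>
  runs backwards because its number is even and nonzero.\<close>

lemma fwd_source:
  assumes "source c j" "c < q" "j < n c"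
  shows "\<not> fwd c (pre_trail c j)" "fwd c j"
  using assms odd_first[of c] large[of c] by (auto simp: source_def fwd_def pre_trail_def)

section \<open>Sums at sinks, sources and through vertices\<close>

lemma net_sink:
  assumes "c < q" "i < m c" "fresh c i" "sink c (trail_no c i)"
  shows "net (w c i) = lab c (pre c i) + lab c i - (int d - 1)"
  using net_fresh[OF assms(1-3)] fwd_sink[OF assms(4,1)] trail_no_less[OF assms(1,2)] trail_no_pre[OF assms(1,2)]
    assms(3) by (simp add: sgn_lab_def)

lemma net_source:
  assumes "c < q" "i < m c" "fresh c i" "source c (trail_no c i)"
  shows "net (w c i) = - (lab c (pre c i) + lab c i) - (int d - 1)"
  using net_fresh[OF assms(1-3)] fwd_source[OF assms(4,1)] trail_no_less[OF assms(1,2)] trail_no_pre[OF assms(1,2)]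
    assms(3) by (simp add: sgn_lab_def)

lemma net_through:
  assumes "c < k"
  shows "net (w c 1) = - (lab c 1 - lab c 0) - (int d - 1)"
proof -
  have c: "c < q" "1 < m c" using assms k_le two_steps[of c] by auto
  have "fresh c 1" using proper[of c 0] c by (auto simp: fresh_def)
  then show ?thesis
    using net_fresh[of c 1] c trail_no_1[of c] assms by (simp add: pre_def sgn_lab_def fwd_def)
qed

text \<open>Names the two labels by level instead of by tour order, so that two sums can be compared
  term by term.\<close>

lemma end_labels:
  assumes "c < q" "i < m c" "fresh c i" "sink c (trail_no c i) \<or> source c (trail_no c i)"
  obtains x y where "x < m c" "y < m c" "lev c (trail_no c x) = lo c (trail_no c i)"
    "lev c (trail_no c y) = hi c (trail_no c i)" "lab c (pre c i) + lab c i = lab c x + lab c y"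
proof -
  have "\<not> (c < k \<and> trail_no c i = 1)" using assms(4) by (auto simp: sink_def source_def)
  then consider
      "lev c (trail_no c (pre c i)) = lo c (trail_no c i)" "lev c (trail_no c i) = hi c (trail_no c i)"
    | "lev c (trail_no c (pre c i)) = hi c (trail_no c i)" "lev c (trail_no c i) = lo c (trail_no c i)"
    using lev_ends[OF assms(1) trail_no_less[OF assms(1,2)]] trail_no_pre[OF assms(1,2)] assms(3) by auto
  then show ?thesis
    using that[of "pre c i" i] that[of i "pre c i"] pre_less[OF assms(1,2)] assms(2) by cases auto
qed

text \<open>By \<open>sink_hi\<close> and \<open>source_hi\<close> the higher levels are ordered
  like the lower ones, or both tie and the tour number decides. Hence both summands
  increase.\<close>

lemma end_labels_less:
  assumes 1: "c < q" "i < m c" "fresh c i" and 2: "c' < q" "i' < m c'" "fresh c' i'"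
  defines "j \<equiv> trail_no c i" and "j' \<equiv> trail_no c' i'"
  assumes ty: "sink c j \<and> sink c' j' \<or> source c j \<and> source c' j'"
    and less: "(of_bool (\<not> c < k) :: nat, lo c j, c) < (of_bool (\<not> c' < k), lo c' j', c')"
  shows "lab c (pre c i) + lab c i < lab c' (pre c' i') + lab c' i'"
proof -
  obtain x y where xy: "x < m c" "y < m c" "lev c (trail_no c x) = lo c j"
    "lev c (trail_no c y) = hi c j" "lab c (pre c i) + lab c i = lab c x + lab c y"
    using end_labels[OF 1] ty unfolding j_def by blast
  obtain x' y' where xy': "x' < m c'" "y' < m c'" "lev c' (trail_no c' x') = lo c' j'"
    "lev c' (trail_no c' y') = hi c' j'" "lab c' (pre c' i') + lab c' i' = lab c' x' + lab c' y'"
    using end_labels[OF 2] ty unfolding j'_def by blast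
  have j: "j < n c" "j' < n c'"
    using trail_no_less 1 2 by (auto simp: j_def j'_def)
  have hi: "hi c j < hi c' j' \<or> hi c j = hi c' j' \<and> lo c j = lo c' j'"
    if "c < k \<longleftrightarrow> c' < k" "lo c j \<le> lo c' j'"
    using ty
  proof
    assume "sink c j \<and> sink c' j'"
    then show ?thesis
      using sink_hi[of c j] sink_hi[of c' j'] 1 2 j that by (auto split: if_splits)
  next
    assume "source c j \<and> source c' j'"
    then show ?thesis
      using source_hi[of c j] source_hi[of c' j'] 1 2 j that by (auto split: if_splits)
  qed
  have "key (c, x) < key (c', x')"
    using less xy xy' by (auto simp: key_def split: if_splits)
  moreover have "key (c, y) < key (c', y')"
    using less hi xy xy' by (cases "c < k"; cases "c' < k") (auto simp: key_def)
  ultimately show ?thesis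
    using lab_less[of c' x' c x] lab_less[of c' y' c y] xy xy' 2 by simp
qed

lemma end_labels_inj:
  assumes 1: "c < q" "i < m c" "fresh c i" and 2: "c' < q" "i' < m c'" "fresh c' i'"
    and ty: "sink c (trail_no c i) \<and> sink c' (trail_no c' i') \<or> source c (trail_no c i) \<and> source c' (trail_no c' i')"
    and eq: "lab c (pre c i) + lab c i = lab c' (pre c' i') + lab c' i'"
  shows "c = c' \<and> i = i'"
proof -
  have "(of_bool (\<not> c < k) :: nat, lo c (trail_no c i), c) = (of_bool (\<not> c' < k), lo c' (trail_no c' i'), c')"
    using end_labels_less[OF 1 2 ty] end_labels_less[OF 2 1] ty eq by (metis less_irrefl neqE)
  then have "c = c'" "lo c (trail_no c i) = lo c (trail_no c i')" by auto
  then have "trail_no c i = trail_no c i'"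
    using lo_inj[of c "trail_no c i" "trail_no c i'"] ty 1 2 trail_no_less by auto
  then show ?thesis using \<open>c = c'\<close> fresh_inj 1 2 by auto
qed

section \<open>Label gaps at the through vertices of odd tours\<close>

text \<open>From one odd tour to the next, the label on trail 0 grows by exactly one, but the first
  label on trail 1 by at least two, since trail 2 of tour \<open>c\<close> lies in between.\<close>

lemma gap_Suc:
  assumes "Suc c < k"
  shows "lab c 1 - lab c 0 < lab (Suc c) 1 - lab (Suc c) 0"
proof -
  have c: "c < q" "Suc c < q" "c < k" using assms k_le by auto
  have t1: "trail_no c 1 = 1" "trail_no (Suc c) 1 = 1" using c trail_no_1 by auto
  \<comment> \<open>Only trail 0 has level 0 in an odd tour, so these single edges head the whole
    order, sorted by tour.\<close>
  have key_0: "key (x, 0) = (0, 0, x, 0, 0)" if "x < k" for x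
    using that by (simp add: key_def lev_def fwd_def)
  have "lab (Suc c) 0 = lab c 0 + 1"
  proof (rule lab_Suc)
    fix c' i' assume z: "c' < q" "i' < m c'" "key (c, 0) < key (c', i')" "key (c', i') < key (Suc c, 0)"
    then have "c' < k" "lev c' (trail_no c' i') = 0"
      using key_0[OF assms] by (auto simp: key_def split: if_splits)
    then have "trail_no c' i' = 0"
      using trail_no_less[OF z(1,2)] by (auto simp: lev_def split: if_splits)
    then have "i' = 0" using trail_no_eq_0 z by simp
    then show False using z key_0 c assms \<open>c' < k\<close> by simp
  qed (use c assms m_pos key_0 in auto)
  moreover have "lab c 1 + 2 \<le> lab (Suc c) 1"
  proof -
    \<comment> \<open>The first step of trail 2, which has level 1 like trail 1; its label separates
      those of \<open>(c, 1)\<close> and \<open>(Suc c, 1)\<close>.\<close>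
    define i where "i = (LEAST i. 2 \<le> trail_no c i)"
    have ex: "2 \<le> trail_no c (m c - 1)"
      using trail_no_last[of c] large[of c] c by simp
    have "2 \<le> trail_no c i" unfolding i_def using ex by (rule LeastI)
    moreover have "i < m c"
      using Least_le[of "\<lambda>i. 2 \<le> trail_no c i" "m c - 1"] ex m_pos[of c] c by (simp add: i_def)
    moreover obtain i' where i': "i = Suc i'" using \<open>2 \<le> trail_no c i\<close> by (cases i) auto
    moreover have "\<not> 2 \<le> trail_no c i'"
      using not_less_Least[of i' "\<lambda>i. 2 \<le> trail_no c i"] i' by (simp add: i_def)
    ultimately have i: "trail_no c i = 2" "i < m c"
      using trail_no_Suc[of c i'] by (auto simp: of_bool_def split: if_splits)
    have lev: "lev c 1 = 1" "lev (Suc c) 1 = 1" "lev c 2 = 1"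
      using large[of c] large[of "Suc c"] c assms by (auto simp: lev_def)
    have "lab c 1 < lab c i"
      using c i t1 lev by (intro lab_less) (auto simp: key_def)
    moreover have "lab c i < lab (Suc c) 1"
      using c assms i t1 lev two_steps[of "Suc c"] by (intro lab_less) (auto simp: key_def)
    ultimately show ?thesis by simp
  qed
  ultimately show ?thesis by simp
qed

lemma gap_strict_mono: "c < c' \<Longrightarrow> c' < k \<Longrightarrow> lab c 1 - lab c 0 < lab c' 1 - lab c' 0"
proof (induction c')
  case (Suc c')
  then show ?case using gap_Suc[of c'] by (cases "c = c'") auto
qed simp

text \<open>The higher trail at a source has level at least 2 or belongs to an even tour, so its
  label alone exceeds \<open>lab c 1\<close>, whose step has level 1 in an odd tour.\<close>

lemma gap_less_source:
  assumes "c < k" and s: "c' < q" "i' < m c'" "fresh c' i'" "source c' (trail_no c' i')"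
  shows "lab c 1 - lab c 0 < lab c' (pre c' i') + lab c' i'"
proof -
  obtain x y where xy: "x < m c'" "y < m c'" "lev c' (trail_no c' y) = hi c' (trail_no c' i')"
    "lab c' (pre c' i') + lab c' i' = lab c' x + lab c' y"
    using end_labels[OF s(1-3)] s(4) by metis
  have c: "c < q" "1 < m c" "0 < m c" using assms k_le two_steps[of c] by auto
  have "2 \<le> hi c' (trail_no c' i')" if "c' < k"
    using source_hi[OF s(4,1) trail_no_less[OF s(1,2)]] that by (auto split: if_splits)
  moreover have "lev c (trail_no c 1) = 1"
    using large[of c] trail_no_1[of c] assms c by (simp add: lev_def)
  ultimately have "lab c 1 < lab c' y"
    using s xy assms by (intro lab_less) (auto simp: key_def)
  then show ?thesis using lab_pos[of c 0] lab_pos[of c' x] c s xy by simp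
qed

text \<open>After adding \<open>int d - 1\<close>, sinks have positive sums, and those of through
  vertices are negative but above those of all sources. So the sum determines the type, and within
  each type monotonicity determines the vertex.\<close>

lemma net_inj:
  assumes 1: "c < q" "i < m c" "fresh c i" and 2: "c' < q" "i' < m c'" "fresh c' i'"
    and eq: "net (w c i) = net (w c' i')"
  shows "c = c' \<and> i = i'"
proof -
  have kinds: "sink c (trail_no c i) \<or> source c (trail_no c i) \<or> c < k \<and> i = 1"
    if "c < q" "i < m c" "fresh c i" for c i
  proof -
    have "fresh c 1" using proper[of c 0] that by (auto simp: fresh_def)
    then have "i = 1" if "trail_no c i = 1"
      using fresh_inj[of c i 1] \<open>fresh c i\<close> trail_no_1[OF \<open>c < q\<close>] that by simp
    then show ?thesis by (auto simp: sink_def source_def)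
  qed
  have pos: "0 < lab c (pre c i) + lab c i" if "c < q" "i < m c" for c i
    using lab_pos[OF that(1) pre_less[OF that]] lab_pos[OF that] by simp
  have gap_pos: "0 < lab c 1 - lab c 0" if "c < k" for c
  proof -
    have c: "c < q" "1 < m c" using that k_le two_steps[of c] by auto
    then have "key (c, 0) < key (c, 1)"
      using trail_no_1[of c] large[of c] that by (auto simp: key_def lev_def)
    then show ?thesis using lab_less[of c 1 c 0] c by simp
  qed
  consider "sink c (trail_no c i)" | "source c (trail_no c i)" | "c < k" "i = 1"
    using kinds[OF 1] by blast
  then show ?thesis
  proof cases
    case s: 1
    have "sink c' (trail_no c' i')"
      using kinds[OF 2] net_sink[OF 1 s] net_source[OF 2] net_through[of c'] eq pos[OF 1(1,2)]
        pos[OF 2(1,2)] gap_pos[of c'] by auto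
    then show ?thesis using end_labels_inj[OF 1 2] s net_sink[OF 1] net_sink[OF 2] eq by simp
  next
    case s: 2
    have "source c' (trail_no c' i')"
      using kinds[OF 2] net_source[OF 1 s] net_sink[OF 2] net_through[of c'] eq pos[OF 1(1,2)]
        pos[OF 2(1,2)] gap_less_source[OF _ 1 s, of c'] by auto
    then show ?thesis using end_labels_inj[OF 1 2] s net_source[OF 1] net_source[OF 2] eq by simp
  next
    case s: 3
    have "c' < k \<and> i' = 1"
      using kinds[OF 2] net_through[OF s(1)] net_sink[OF 2] net_source[OF 2] eq s
        pos[OF 2(1,2)] gap_pos[OF s(1)] gap_less_source[OF s(1) 2] by auto
    then show ?thesis
      using gap_strict_mono[of c c'] gap_strict_mono[of c' c] net_through[of c] net_through[of c'] s eq
      by (cases c c' rule: linorder_cases) auto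
  qed
qed

section \<open>From signed labels to an antimagic orientation\<close>

lemma first_visit:
  assumes "v \<in> w c ` {..<m c}"
  obtains i where "i < m c" "fresh c i" "w c i = v"
proof -
  define i where "i = (LEAST i. w c i = v)"
  obtain i0 where i0: "i0 < m c" "w c i0 = v" using assms by auto
  have "w c i = v" unfolding i_def by (rule LeastI[of _ i0]) (rule i0)
  moreover have "i \<le> i0" unfolding i_def by (rule Least_le) (rule i0)
  moreover have "w c l \<noteq> v" if "l < i" for l
    using not_less_Least that unfolding i_def by blast
  then have "v \<notin> w c ` {..<i}" by blast
  ultimately show ?thesis using that[of i] i0 by (simp add: fresh_def)
qed

lemma inj_on_net: "inj_on net (\<Union>c<q. w c ` {..<m c})"
proof (rule inj_onI)
  fix u v assume u: "u \<in> (\<Union>c<q. w c ` {..<m c})" and v: "v \<in> (\<Union>c<q. w c ` {..<m c})"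
    and eq: "net u = net v"
  obtain c where c: "c < q" "u \<in> w c ` {..<m c}" using u by blast
  obtain i where i: "i < m c" "fresh c i" "w c i = u" using c(2) by (rule first_visit)
  obtain c' where c': "c' < q" "v \<in> w c' ` {..<m c'}" using v by blast
  obtain i' where i': "i' < m c'" "fresh c' i'" "w c' i' = v" using c'(2) by (rule first_visit)
  show "u = v" using net_inj[OF c(1) i(1,2) c'(1) i'(1,2)] eq i i' by auto
qed

lemma antimagic:
  assumes bij: "bij_betw (\<lambda>(c, i). step_edge (w c) i) steps E"
  shows "has_antimagic_orientation (\<Union>c<q. w c ` {..<m c}) E"
proof -
  let ?ed = "\<lambda>(c, i). step_edge (w c) i"
  define g where "g = the_inv_into steps ?ed"
  define f where "f e = rank steps key (g e)" for e
  define h where "h e = (case g e of (c, i) \<Rightarrow> if fwd c (trail_no c i) then w c (Suc i) else w c i)" for e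
  have g: "g (?ed x) = x" if "x \<in> steps" for x
    using that bij by (simp add: g_def the_inv_into_f_f bij_betw_def)
  have E: "E = ?ed ` steps" using bij by (simp add: bij_betw_def)
  have finE: "finite E" using E finite_steps by simp
  have "bij_betw g E steps" using bij unfolding g_def by (rule bij_betw_the_inv_into)
  then have "bij_betw (rank steps key \<circ> g) E {1..card steps}"
    using bij_betw_rank[OF finite_steps inj_key] by (rule bij_betw_trans)
  then have "bij_betw f E {1..card E}"
    using bij_betw_same_card[OF bij] by (simp add: f_def[abs_def] comp_def)
  moreover have h: "h e \<in> e" if "e \<in> E" for e
    using that g by (auto simp: E h_def step_edge_def)
  moreover have "vertex_sum E h f = net"
  proof
    fix v
    have "vertex_sum E h f v = (\<Sum>e\<in>E. int (f e) * (of_bool (h e = v) - of_bool (v \<in> e \<and> h e \<noteq> v)))"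
    proof -
      have "(\<Sum>e\<in>{e\<in>E. P e}. int (f e)) = (\<Sum>e\<in>E. int (f e) * of_bool (P e))" for P
        using finE by (simp add: of_bool_def if_distrib sum.inter_filter cong: if_cong)
      moreover have "{e\<in>E. v \<in> e \<and> h e = v} = {e\<in>E. h e = v}" using h by auto
      ultimately show ?thesis by (simp add: vertex_sum_def right_diff_distrib sum_subtractf)
    qed
    also have "\<dots> = (\<Sum>x\<in>steps. int (f (?ed x)) * (of_bool (h (?ed x) = v) - of_bool (v \<in> ?ed x \<and> h (?ed x) \<noteq> v)))"
      using bij by (rule sum.reindex_bij_betw[symmetric])
    also have "\<dots> = net v"
      unfolding net_def
    \<comment> \<open>A step has distinct ends, so exactly one of them is the head; reversing the
      arc swaps the two indicators, which is the sign in \<open>sgn_lab\<close>.\<close>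
    proof (intro sum.cong refl)
      fix x assume x: "x \<in> steps"
      obtain c i where ci: "x = (c, i)" by (cases x)
      then have "w c i \<noteq> w c (Suc i)" using x proper by (auto simp: steps_def)
      then show "int (f (?ed x)) * (of_bool (h (?ed x) = v) - of_bool (v \<in> ?ed x \<and> h (?ed x) \<noteq> v))
        = (case x of (c, i) \<Rightarrow> sgn_lab c i * (of_bool (w c (Suc i) = v) - of_bool (w c i = v)))"
        using g[OF x] ci by (auto simp: f_def h_def sgn_lab_def lab_def step_edge_def)
    qed
    finally show "vertex_sum E h f v = net v" .
  qed
  ultimately show ?thesis
    using inj_on_net unfolding has_antimagic_orientation_def by metis
qed

end

section \<open>Even regular graphs\<close>

lemma components_disjoint:
  assumes "simple_graph V E" "C \<in> components V E" "D \<in> components V E" "v \<in> C" "v \<in> D"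
  shows "C = D"
proof -
  have V: "X \<subseteq> V" if "X \<in> components V E" for X
    using that by (auto simp: components_def)
  have sub: "X \<subseteq> Y" if "X \<in> components V E" "Y \<in> components V E" "v \<in> X" "v \<in> Y" for X Y
  proof
    fix x assume "x \<in> X"
    then have "(adj E)\<^sup>*\<^sup>* v x" using component_connected[OF assms(1)] that by blast
    then show "x \<in> Y" using V[OF that(1)] \<open>x \<in> X\<close> that(2,4)
      by (auto simp: components_def intro: rtranclp_trans)
  qed
  show ?thesis using sub assms by blast
qed

lemma Union_components: "\<Union>(components V E) = V"
  by (auto simp: components_def)

lemma edge_in_component:
  assumes "simple_graph V E" "e \<in> E"
  obtains C where "C \<in> components V E" "e \<subseteq> C"
proof -
  have e: "card e = 2" "e \<subseteq> V" using assms by (auto simp: simple_graph_def)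
  then obtain a b where ab: "e = {a, b}" by (auto simp: card_2_iff)
  then obtain C where "C \<in> components V E" "a \<in> C" using e Union_components[of V E] by blast
  moreover from this have "b \<in> C" using component_closed[OF assms(1)] ab assms(2) by blast
  ultimately show ?thesis using that ab by blast
qed

text \<open>All neighbours of \<open>v\<close> lie in \<open>C - {v}\<close>. This bounds the size
  of odd components from below.\<close>

lemma degree_less_card_component:
  assumes "simple_graph V E" "C \<in> components V E" "v \<in> C"
  shows "degree E v < card C"
proof -
  have fin: "finite C" using assms by (auto simp: components_def simple_graph_def)
  have "{e \<in> E. v \<in> e} \<subseteq> (\<lambda>x. {v, x}) ` (C - {v})"
  proof
    fix e assume e: "e \<in> {e \<in> E. v \<in> e}"
    then have card: "card e = 2" using assms(1) by (auto simp: simple_graph_def)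
    moreover have "v \<in> e" using e by simp
    ultimately obtain x where x: "e = {v, x}" by (rule doubleton_with_memberE)
    then have "x \<in> C" "x \<noteq> v" using component_closed[OF assms] e card by auto
    then show "e \<in> (\<lambda>x. {v, x}) ` (C - {v})" using x by blast
  qed
  then have "degree E v \<le> card (C - {v})"
    unfolding degree_def using fin by (meson card_image_le card_mono finite_Diff finite_imageI le_trans)
  then show ?thesis using fin assms(3) card_Diff1_less[of C v] by simp
qed

theorem even_regular_has_antimagic_orientation:
  assumes d: "d \<ge> 2" and sg: "simple_graph V E" and reg: "regular V E (2 * d)"
  shows "has_antimagic_orientation V E"
proof -
  let ?K = "components V E"
  have finK: "finite ?K" using sg by (auto simp: components_def simple_graph_def)
  obtain os where os: "set os = {C \<in> ?K. odd (card C)}" "distinct os"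
    using finite_distinct_list[of "{C \<in> ?K. odd (card C)}"] finK by auto
  obtain es where es: "set es = {C \<in> ?K. even (card C)}" "distinct es"
    using finite_distinct_list[of "{C \<in> ?K. even (card C)}"] finK by auto
  \<comment> \<open>Listing odd components first turns parity into the comparison
    \<open>c < k\<close>.\<close>
  define cs where "cs = os @ es"
  define q where "q = length cs"
  define k where "k = length os"
  have cs: "distinct cs" "set cs = ?K" using os es by (auto simp: cs_def)
  have inK: "cs ! c \<in> ?K" if "c < q" for c using that cs(2) by (auto simp: q_def)
  have odd_first: "odd (card (cs ! c)) \<longleftrightarrow> c < k" if "c < q" for c
  proof (cases "c < k")
    case True
    then have "cs ! c \<in> set os" by (simp add: cs_def k_def nth_append)
    then show ?thesis using os True by simp
  next
    case False
    then have "cs ! c \<in> set es" using that by (simp add: cs_def k_def q_def nth_append)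
    then show ?thesis using es False by simp
  qed
  have deg: "degree E v = 2 * d" if "v \<in> V" for v using reg that by (simp add: regular_def)
  have "\<exists>m w. euler_tour {e \<in> E. e \<subseteq> cs ! c} (cs ! c) m w" if "c < q" for c
    by (rule component_euler_tour[OF sg inK[OF that]]) (use deg d in auto)
  then obtain m w where "\<And>c. c < q \<Longrightarrow> euler_tour {e \<in> E. e \<subseteq> cs ! c} (cs ! c) (m c) (w c)"
    by metis
  note tour = this[unfolded euler_tour_def]
  have same: "c = c'" if "c < q" "c' < q" "v \<in> cs ! c" "v \<in> cs ! c'" for c c' v
    using components_disjoint[OF sg inK inK, of c c' v] that cs(1)
    by (auto simp: q_def nth_eq_iff_index_eq)
  have visit: "w c i \<in> cs ! c" if "c < q" "i < m c" for c i
    using tour[OF that(1)] that(2) by blast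
  have proper: "w c i \<noteq> w c (Suc i)" if "c < q" "i < m c" for c i
  proof -
    have "step_edge (w c) i \<in> E" using tour[OF that(1)] that(2) by blast
    then have "card (step_edge (w c) i) = 2" using sg by (simp add: simple_graph_def)
    then show ?thesis by (auto simp: step_edge_def)
  qed
  interpret tours q k d m w
  proof
    fix c assume c: "c < q"
    show "0 < m c" "w c (m c) = w c 0" using tour[OF c] by auto
    show "odd (card (w c ` {..<m c})) \<longleftrightarrow> c < k" using tour[OF c] odd_first[OF c] by simp
    fix i assume i: "i < m c"
    show "w c i \<noteq> w c (Suc i)" using proper c i .
    have "degree {e \<in> E. e \<subseteq> cs ! c} (w c i) = 2 * d"
      using visit[OF c i] component_degree[OF sg inK[OF c], of "w c i"] deg Union_components[of V E] inK[OF c] by auto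
    moreover have "degree {e \<in> E. e \<subseteq> cs ! c} (w c i) = card {e \<in> step_edge (w c) ` {..<m c}. w c i \<in> e}"
      using tour[OF c] by (simp add: degree_def)
    moreover have "\<dots> = card {j. j < m c \<and> w c j = w c i} + card {j. j < m c \<and> w c (Suc j) = w c i}"
      using tour[OF c] proper[OF c] by (intro card_incident_steps) auto
    \<comment> \<open>On a closed tour arrivals and departures agree in number, so
      \<open>2 * d\<close> incident edges mean \<open>d\<close> visits.\<close>
    moreover have "card {j. j < m c \<and> w c (Suc j) = w c i} = card {j. j < m c \<and> w c j = w c i}"
      using card_shifted_visits[of "m c" "w c" "w c i"] tour[OF c] by simp
    ultimately show "card {j. j < m c \<and> w c j = w c i} = d" by simp
    fix c' i' assume "c' < q" "i' < m c'" "w c i = w c' i'"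
    then show "c = c'" using same[of c c' "w c i"] visit[OF c i] visit[of c' i'] c by simp
  next
    show "k \<le> q" by (simp add: k_def q_def cs_def)
    fix c assume "c < k"
    then have c: "c < q" using \<open>k \<le> q\<close> by simp
    then have "w c 0 \<in> cs ! c" using tour[OF c] visit[of c 0] by simp
    then have "2 * d < card (cs ! c)"
      using degree_less_card_component[OF sg inK[OF c]] deg Union_components[of V E] inK[OF c] by fastforce
    then show "5 \<le> card (w c ` {..<m c})" using tour[OF c] d by simp
  qed
  have "bij_betw (\<lambda>(c, i). step_edge (w c) i) steps E"
  proof (rule bij_betw_imageI)
    show "inj_on (\<lambda>(c, i). step_edge (w c) i) steps"
    proof (rule inj_onI, clarify)
      fix c i c' i' assume x: "(c, i) \<in> steps" "(c', i') \<in> steps" and eq: "step_edge (w c) i = step_edge (w c') i'"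
      then have c: "c < q" "i < m c" "c' < q" "i' < m c'" by (auto simp: steps_def)
      then have "step_edge (w c) i \<subseteq> cs ! c" "step_edge (w c') i' \<subseteq> cs ! c'"
        using tour[of c] tour[of c'] by blast+
      moreover have "w c i \<in> step_edge (w c) i" by (simp add: step_edge_def)
      ultimately have "c = c'" using same[OF c(1,3)] eq by blast
      moreover from this have "i = i'"
        using inj_onD[of "step_edge (w c)" "{..<m c}" i i'] tour[OF c(1)] c eq by simp
      ultimately show "c = c' \<and> i = i'" by simp
    qed
    have "(\<lambda>(c, i). step_edge (w c) i) ` steps = (\<Union>c<q. step_edge (w c) ` {..<m c})"
      by (auto simp: steps_def image_iff)
    also have "\<dots> = (\<Union>c<q. {e \<in> E. e \<subseteq> cs ! c})" using tour by (intro SUP_cong) simp_all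
    also have "\<dots> = E"
    proof
      show "E \<subseteq> (\<Union>c<q. {e \<in> E. e \<subseteq> cs ! c})"
      proof
        fix e assume e: "e \<in> E"
        obtain C where "C \<in> ?K" "e \<subseteq> C" using edge_in_component[OF sg e] .
        then obtain c where "c < q" "cs ! c = C" using cs(2) by (metis in_set_conv_nth q_def)
        then show "e \<in> (\<Union>c<q. {e \<in> E. e \<subseteq> cs ! c})" using e \<open>e \<subseteq> C\<close> by blast
      qed
    qed blast
    finally show "(\<lambda>(c, i). step_edge (w c) i) ` steps = E" .
  qed
  moreover have "(\<Union>c<q. w c ` {..<m c}) = V"
  proof -
    have "(\<Union>c<q. w c ` {..<m c}) = (\<Union>c<q. cs ! c)" using tour by (intro SUP_cong) simp_all
    also have "\<dots> = \<Union>(set cs)" by (auto simp: q_def set_conv_nth)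
    finally show ?thesis using cs(2) Union_components by metis
  qed
  ultimately show ?thesis using antimagic by metis
qed

theorem theorem1:
  fixes V :: "'a set" and E :: "'a set set" and d :: nat
  assumes "d \<ge> 2" and "simple_graph V E" and "regular V E (2 * d)"
  shows "(odd_comp_count V E \<le> 5 * d + 4 \<longrightarrow> has_antimagic_orientation V E) \<and>
         (\<forall>x0::nat. odd_comp_count V E \<ge> 5 * d + 5 \<and> x0 > 0 \<and>
            ((\<exists>r\<in>{0..d + 8}. odd_comp_count V E = (2 * d - 2) * (x0 + 2) + r) \<or>
             (\<exists>r\<in>{d + 9..2 * d - 3}. odd_comp_count V E = (2 * d - 2) * (x0 + 1) + r)) \<and>
            min_odd_comp_size V E \<ge> 2 * x0 + 5
          \<longrightarrow> has_antimagic_orientation V E)"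
  using even_regular_has_antimagic_orientation[OF assms] by blast

end
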